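(* For every infinite cardinal $\kappa$ and each positive integer $k$, $\mathrm{SDHL}(1,k,\kappa)$ holds.
   Context: A tree $T\subseteq {}^{<\kappa}\kappa$ is a set of sequences closed under initial segments, ordered by end-extension $\sqsubseteq$; $T(\zeta):=T\cap{}^{\zeta}\kappa$ is its $\zeta$-th level. $T$ is a $\kappa$-tree if $|T|=\kappa$ and every level of $T$ has cardinality less than $\kappa$. $T$ is perfect if every node of $T$ has an extension in $T$ which splits in $T$. $T\subseteq{}^{<\kappa}\kappa$ is regular if it is a perfect $\kappa$-tree in which every maximal branch has cofinality $\kappa$. $\mathrm{Cone}(t):=\{s\in{}^{<\kappa}\kappa:s\sqsupseteq t\}$. $X\subseteq{}^{<\kappa}\kappa$ dominates $Y\subseteq{}^{<\kappa}\kappa$ if $(\forall y\in Y)(\exists x\in X)\ y\sqsubseteq x$. Level-product: for an ordinal $\delta>0$ and $X_i\subseteq{}^{<\kappa}\kappa$ ($i<\delta$), with $X_i(\zeta):=X_i\cap{}^{\zeta}\kappa$, $\bigotimes_{i<\delta}X_i:=\{\langle x_i:i<\delta\rangle:(\exists\zeta<\kappa)(\forall i<\delta)\ x_i\in X_i(\zeta)\}$. $\mathrm{SDHL}(\delta,\sigma,\kappa)$ (for nonzero ordinals $\delta,\sigma$ and an infinite cardinal $\kappa$) is the statement: given any sequence $\langle T_i\subseteq{}^{<\kappa}\kappa:i<\delta\rangle$ of regular trees and any coloring $c:\bigotimes_{i<\delta}T_i\to\sigma$, there exist $\zeta<\zeta'<\kappa$, $\langle t_i\in T_i(\zeta):i<\delta\rangle$,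 and $\langle X_i\subseteq T_i(\zeta'):i<\delta\rangle$ such that each $X_i$ dominates $T_i(\zeta+1)\cap\mathrm{Cone}(t_i)$ and $|c[\bigotimes_{i<\delta}X_i]|=1$. (For $\delta=1$ this concerns a single regular tree $T$ and a coloring $c:T\to\sigma$.) *)

theory Defs
  imports Complex_Main "HOL-Library.FuncSet"
begin

unbundle cardinal_syntax

text \<open>
  An infinite cardinal \<open>\<kappa>\<close> is a cardinal order in the sense of the library (\<open>Cinfinite \<kappa>\<close>).  The
  ordinals below \<open>\<kappa>\<close> are the elements of \<open>Field \<kappa>\<close>: the element \<open>\<zeta>\<close> stands for the order type of
  \<open>underS \<kappa> \<zeta>\<close>.  A sequence of length \<open>\<zeta>\<close> is a partial function with domain \<open>underS \<kappa> \<zeta>\<close>.  The domains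
  of such sequences are initial segments of \<open>\<kappa>\<close>, so end-extension is the library relation
  \<open>\<subseteq>\<^sub>m\<close> on partial functions.
\<close>

definition seqs_of_length :: "'a rel \<Rightarrow> 'a \<Rightarrow> ('a \<rightharpoonup> 'a) set" where
  "seqs_of_length \<kappa> \<zeta> = {s. dom s = underS \<kappa> \<zeta> \<and> ran s \<subseteq> Field \<kappa>}"

definition seqs :: "'a rel \<Rightarrow> ('a \<rightharpoonup> 'a) set" where
  "seqs \<kappa> = (\<Union>\<zeta>\<in>Field \<kappa>. seqs_of_length \<kappa> \<zeta>)"

definition level :: "'a rel \<Rightarrow> ('a \<rightharpoonup> 'a) set \<Rightarrow> 'a \<Rightarrow> ('a \<rightharpoonup> 'a) set" where
  "level \<kappa> X \<zeta> = X \<inter> seqs_of_length \<kappa> \<zeta>"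

text \<open>The ordinal \<open>\<zeta> + 1\<close>; it lies below \<open>\<kappa>\<close> because an infinite cardinal is a limit ordinal.\<close>
definition ord_succ :: "'a rel \<Rightarrow> 'a \<Rightarrow> 'a" where
  "ord_succ \<kappa> \<zeta> = wo_rel.suc \<kappa> {\<zeta>}"

definition Cone :: "'a rel \<Rightarrow> ('a \<rightharpoonup> 'a) \<Rightarrow> ('a \<rightharpoonup> 'a) set" where
  "Cone \<kappa> t = {s \<in> seqs \<kappa>. t \<subseteq>\<^sub>m s}"

definition dominates :: "('a \<rightharpoonup> 'a) set \<Rightarrow> ('a \<rightharpoonup> 'a) set \<Rightarrow> bool" where
  "dominates X Y \<longleftrightarrow> (\<forall>y\<in>Y. \<exists>x\<in>X. y \<subseteq>\<^sub>m x)"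

definition tree :: "'a rel \<Rightarrow> ('a \<rightharpoonup> 'a) set \<Rightarrow> bool" where
  "tree \<kappa> T \<longleftrightarrow> T \<subseteq> seqs \<kappa> \<and> (\<forall>t\<in>T. \<forall>s\<in>seqs \<kappa>. s \<subseteq>\<^sub>m t \<longrightarrow> s \<in> T)"

definition kappa_tree :: "'a rel \<Rightarrow> ('a \<rightharpoonup> 'a) set \<Rightarrow> bool" where
  "kappa_tree \<kappa> T \<longleftrightarrow> tree \<kappa> T \<and> |T| =o \<kappa> \<and> (\<forall>\<zeta>\<in>Field \<kappa>. |level \<kappa> T \<zeta>| <o \<kappa>)"

text \<open>A node splits if it has at least two immediate successors.\<close>
definition splits_in :: "'a rel \<Rightarrow> ('a \<rightharpoonup> 'a) set \<Rightarrow> ('a \<rightharpoonup> 'a) \<Rightarrow> bool" where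
  "splits_in \<kappa> T t \<longleftrightarrow>
    (\<exists>\<zeta>\<in>Field \<kappa>. t \<in> level \<kappa> T \<zeta> \<and>
      (\<exists>x \<in> level \<kappa> T (ord_succ \<kappa> \<zeta>) \<inter> Cone \<kappa> t.
       \<exists>y \<in> level \<kappa> T (ord_succ \<kappa> \<zeta>) \<inter> Cone \<kappa> t. x \<noteq> y))"

definition perfect_tree :: "'a rel \<Rightarrow> ('a \<rightharpoonup> 'a) set \<Rightarrow> bool" where
  "perfect_tree \<kappa> T \<longleftrightarrow> tree \<kappa> T \<and> (\<forall>t\<in>T. \<exists>s\<in>T. t \<subseteq>\<^sub>m s \<and> splits_in \<kappa> T s)"

text \<open>\<open>pred_on.maxchain\<close> passes to the reflexive closure of its relation, so the reflexive \<open>\<subseteq>\<^sub>m\<close> may be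
  supplied directly.\<close>
definition maximal_branch :: "('a \<rightharpoonup> 'a) set \<Rightarrow> ('a \<rightharpoonup> 'a) set \<Rightarrow> bool" where
  "maximal_branch T B \<longleftrightarrow> pred_on.maxchain T (\<subseteq>\<^sub>m) B"

text \<open>\<open>\<kappa>\<close> is the least cardinality of a cofinal subset of the chain \<open>B\<close>.\<close>
definition has_cofinality :: "'a rel \<Rightarrow> ('a \<rightharpoonup> 'a) set \<Rightarrow> bool" where
  "has_cofinality \<kappa> B \<longleftrightarrow>
    (\<exists>C\<subseteq>B. dominates C B \<and> |C| =o \<kappa>) \<and> (\<forall>C\<subseteq>B. dominates C B \<longrightarrow> \<kappa> \<le>o |C| )"

definition regular_tree :: "'a rel \<Rightarrow> ('a \<rightharpoonup> 'a) set \<Rightarrow> bool" where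
  "regular_tree \<kappa> T \<longleftrightarrow>
    kappa_tree \<kappa> T \<and> perfect_tree \<kappa> T \<and> (\<forall>B. maximal_branch T B \<longrightarrow> has_cofinality \<kappa> B)"

text \<open>
  The ordinals \<open>\<delta>\<close> and \<open>\<sigma>\<close> are well-orders.  The ordinals below them are the elements of their fields,
  and a \<open>\<delta>\<close>-sequence is an extensional function on \<open>Field \<delta>\<close>.
\<close>

definition level_product ::
    "'a rel \<Rightarrow> 'd rel \<Rightarrow> ('d \<Rightarrow> ('a \<rightharpoonup> 'a) set) \<Rightarrow> ('d \<Rightarrow> ('a \<rightharpoonup> 'a)) set" where
  "level_product \<kappa> \<delta> X = (\<Union>\<zeta>\<in>Field \<kappa>. \<Pi>\<^sub>E i\<in>Field \<delta>. level \<kappa> (X i) \<zeta>)"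

definition SDHL :: "'d rel \<Rightarrow> 's rel \<Rightarrow> 'a rel \<Rightarrow> bool" where
  "SDHL \<delta> \<sigma> \<kappa> \<longleftrightarrow>
    (\<forall>T c. (\<forall>i\<in>Field \<delta>. regular_tree \<kappa> (T i)) \<and> c \<in> level_product \<kappa> \<delta> T \<rightarrow> Field \<sigma> \<longrightarrow>
      (\<exists>\<zeta>'\<in>Field \<kappa>. \<exists>\<zeta>\<in>underS \<kappa> \<zeta>'. \<exists>t X.
        (\<forall>i\<in>Field \<delta>.
          t i \<in> level \<kappa> (T i) \<zeta> \<and>
          X i \<subseteq> level \<kappa> (T i) \<zeta>' \<and>
          dominates (X i) (level \<kappa> (T i) (ord_succ \<kappa> \<zeta>) \<inter> Cone \<kappa> (t i))) \<and>
        card (c ` level_product \<kappa> \<delta> X) = 1))"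

end

theory Submission
  imports Defs
begin

text \<open>
  Suppose that no colour class, restricted to a single level, dominates the immediate successors of a
  node below that level.  Starting from any node, pass repeatedly to an immediate successor so that
  one more colour is missing, on cofinally many levels, above the new node.  Every higher level on
  which the previous colours are missing provides such a successor.  There are fewer than \<open>\<kappa>\<close>
  immediate successors, and \<open>\<kappa>\<close> is regular because it is the cofinality of a branch, so one successor
  serves cofinally many levels.  Once all of the finitely many colours are missing, the last node has
  no extensions on cofinally many levels, whereas every node lies on a branch that meets every level.
\<close>

section \<open>Cofinal subsets of a regular cardinal\<close>

lemma cofinal_mono: "cofinal A r \<Longrightarrow> A \<subseteq> B \<Longrightarrow> cofinal B r"
  unfolding cofinal_def by blast

lemma cofinal_Field: "Cinfinite r \<Longrightarrow> cofinal (Field r) r"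
  using infinite_Card_order_limit[of r] unfolding cofinal_def cinfinite_def by blast

lemma Card_order_wo_rel: "Card_order r \<Longrightarrow> wo_rel r"
  by (simp add: card_order_on_well_order_on wo_rel_def)

lemma underS_downward_closed:
  "wo_rel r \<Longrightarrow> b \<in> underS r c \<Longrightarrow> (a, b) \<in> r \<Longrightarrow> a \<in> underS r c"
  using wo_rel.underS_ofilter[of r c] by (auto simp: wo_rel.ofilter_def under_def)

lemma cofinal_strictly_above:
  assumes "wo_rel r" and "cofinal A r" and "\<zeta> \<in> Field r"
  shows "cofinal {a \<in> A. \<zeta> \<in> underS r a} r"
  unfolding cofinal_def
proof
  fix \<eta> assume "\<eta> \<in> Field r"
  define \<mu> where "\<mu> = wo_rel.max2 r \<eta> \<zeta>"
  have \<mu>: "(\<eta>, \<mu>) \<in> r" "(\<zeta>, \<mu>) \<in> r"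
    using wo_rel.max2_greater[OF assms(1) \<open>\<eta> \<in> Field r\<close> assms(3)] by (simp_all add: \<mu>_def)
  then obtain a where a: "a \<in> A" "\<mu> \<in> underS r a"
    using assms(2) unfolding cofinal_def underS_def by (blast dest: FieldI2)
  with \<mu> have "\<eta> \<in> underS r a" "\<zeta> \<in> underS r a"
    by (blast intro: underS_downward_closed[OF assms(1)])+
  with a(1) show "\<exists>b\<in>{a \<in> A. \<zeta> \<in> underS r a}. \<eta> \<noteq> b \<and> (\<eta>, b) \<in> r"
    by (auto simp: underS_def)
qed

lemma cofinal_UNION_regularCard:
  assumes "Card_order r" and "regularCard r" and "|I| <o r" and "cofinal (\<Union>i\<in>I. A i) r"
  shows "\<exists>i\<in>I. cofinal (A i) r"
proof (rule ccontr)
  assume not_cofinal: "\<not> (\<exists>i\<in>I. cofinal (A i) r)"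
  have wo: "wo_rel r" using assms(1) by (rule Card_order_wo_rel)
  define bounded_by where "bounded_by j = {i \<in> I. \<forall>a\<in>A i. j \<notin> underS r a}" for j
  have "bounded_by j \<subseteq> bounded_by k" if "(j, k) \<in> r" for j k
    using that unfolding bounded_by_def by (blast intro: underS_downward_closed[OF wo])
  then have "relChain r bounded_by" by (simp add: relChain_def)
  moreover have "I \<subseteq> (\<Union>j\<in>Field r. bounded_by j)"
    using not_cofinal by (auto simp: cofinal_def bounded_by_def underS_def)
  ultimately obtain j where "j \<in> Field r" "I \<subseteq> bounded_by j"
    using regularCard_UNION[OF assms(1,2)] assms(3) by blast
  with assms(4) show False by (auto simp: cofinal_def bounded_by_def underS_def)
qed

section \<open>Sequences and levels\<close>

lemma in_levelD: "x \<in> level \<kappa> X \<zeta> \<Longrightarrow> x \<in> X \<and> dom x = underS \<kappa> \<zeta>"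
  by (simp add: level_def seqs_of_length_def)

lemma tree_level_cases:
  assumes "tree \<kappa> T" and "x \<in> T"
  obtains \<zeta> where "\<zeta> \<in> Field \<kappa>" "x \<in> level \<kappa> T \<zeta>"
  using assms unfolding tree_def seqs_def level_def by blast

lemma underS_subset_iff:
  "wo_rel r \<Longrightarrow> a \<in> Field r \<Longrightarrow> b \<in> Field r \<Longrightarrow> underS r a \<subseteq> underS r b \<longleftrightarrow> (a, b) \<in> r"
  by (simp add: underS_incl_iff wo_rel.LIN)

lemma map_le_if_dom_subset:
  assumes "x \<subseteq>\<^sub>m y \<or> y \<subseteq>\<^sub>m x" and "dom x \<subseteq> dom y"
  shows "x \<subseteq>\<^sub>m y"
  using assms unfolding map_le_def by (metis subsetD)

lemma level_map_le:
  assumes "wo_rel \<kappa>" and "x \<in> level \<kappa> X \<zeta>" and "y \<in> level \<kappa> Y \<eta>" and "(\<zeta>, \<eta>) \<in> \<kappa>"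
    and "x \<subseteq>\<^sub>m y \<or> y \<subseteq>\<^sub>m x"
  shows "x \<subseteq>\<^sub>m y"
proof (rule map_le_if_dom_subset[OF assms(5)])
  have "underS \<kappa> \<zeta> \<subseteq> underS \<kappa> \<eta>"
    using assms(1,4) by (simp add: underS_subset_iff FieldI1 FieldI2)
  then show "dom x \<subseteq> dom y"
    using assms(2,3) by (simp add: in_levelD)
qed

lemma seqs_map_le_linear:
  assumes "wo_rel \<kappa>" and "x \<in> seqs \<kappa>" and "y \<in> seqs \<kappa>" and "x \<subseteq>\<^sub>m z" and "y \<subseteq>\<^sub>m z"
  shows "x \<subseteq>\<^sub>m y \<or> y \<subseteq>\<^sub>m x"
proof -
  have agree: "x a = y a" if "a \<in> dom x" "a \<in> dom y" for a
    using that assms(4,5) by (simp add: map_le_def)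
  obtain \<zeta> \<eta> where "\<zeta> \<in> Field \<kappa>" "dom x = underS \<kappa> \<zeta>" "\<eta> \<in> Field \<kappa>" "dom y = underS \<kappa> \<eta>"
    using assms(2,3) by (auto simp: seqs_def seqs_of_length_def)
  then have "dom x \<subseteq> dom y \<or> dom y \<subseteq> dom x"
    using wo_rel.TOTALS[OF assms(1)] by (simp add: underS_subset_iff assms(1))
  with agree show ?thesis by (force simp: map_le_def)
qed

lemma restrict_map_in_seqs_of_length:
  assumes "wo_rel \<kappa>" and "x \<in> seqs_of_length \<kappa> \<eta>" and "(\<zeta>, \<eta>) \<in> \<kappa>"
  shows "x |` underS \<kappa> \<zeta> \<in> seqs_of_length \<kappa> \<zeta>"
proof -
  have "underS \<kappa> \<zeta> \<subseteq> underS \<kappa> \<eta>"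
    using assms(1,3) by (simp add: underS_subset_iff FieldI1 FieldI2)
  moreover have "ran (x |` underS \<kappa> \<zeta>) \<subseteq> ran x"
    by (auto simp: ran_def restrict_map_def)
  ultimately show ?thesis
    using assms(2) by (auto simp: seqs_of_length_def)
qed

lemma ord_succ_greater:
  assumes "Cinfinite \<kappa>" and "\<zeta> \<in> Field \<kappa>"
  shows "(\<zeta>, ord_succ \<kappa> \<zeta>) \<in> \<kappa>"
proof -
  have wo: "wo_rel \<kappa>" using assms(1) Card_order_wo_rel by blast
  have "AboveS \<kappa> {\<zeta>} \<noteq> {}"
    using cofinal_Field[OF assms(1)] assms(2) by (auto simp: cofinal_def AboveS_def)
  then show ?thesis
    unfolding ord_succ_def using wo_rel.suc_greater[OF wo, of "{\<zeta>}"] assms(2) by simp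
qed

section \<open>Maximal branches\<close>

lemma chain_map_le_iff:
  fixes T :: "('a \<rightharpoonup> 'b) set"
  shows "pred_on.chain T (\<subseteq>\<^sub>m) B \<longleftrightarrow> B \<subseteq> T \<and> (\<forall>x\<in>B. \<forall>y\<in>B. x \<subseteq>\<^sub>m y \<or> y \<subseteq>\<^sub>m x)"
proof -
  have "(\<subseteq>\<^sub>m)\<^sup>=\<^sup>= = ((\<subseteq>\<^sub>m) :: ('a \<rightharpoonup> 'b) \<Rightarrow> _)" by (intro ext) auto
  then show ?thesis by (simp only: pred_on.chain_def)
qed

lemma maximal_branch_subset: "maximal_branch T B \<Longrightarrow> B \<subseteq> T"
  by (simp add: maximal_branch_def pred_on.maxchain_def chain_map_le_iff)

lemma maximal_branch_linear:
  "maximal_branch T B \<Longrightarrow> x \<in> B \<Longrightarrow> y \<in> B \<Longrightarrow> x \<subseteq>\<^sub>m y \<or> y \<subseteq>\<^sub>m x"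
  by (simp add: maximal_branch_def pred_on.maxchain_def chain_map_le_iff)

lemma maximal_branch_memI:
  assumes B: "maximal_branch T B" and "x \<in> T" and "\<And>y. y \<in> B \<Longrightarrow> x \<subseteq>\<^sub>m y \<or> y \<subseteq>\<^sub>m x"
  shows "x \<in> B"
proof -
  have "pred_on.chain T (\<subseteq>\<^sub>m) (insert x B)"
    using assms maximal_branch_subset[OF B] maximal_branch_linear[OF B]
    by (auto simp: chain_map_le_iff)
  then show ?thesis
    using B unfolding maximal_branch_def pred_on.maxchain_def by blast
qed

lemma exists_maximal_branch_through:
  assumes "t \<in> T"
  obtains B where "maximal_branch T B" "t \<in> B"
proof -
  define A where "A = {x \<in> T. x \<subseteq>\<^sub>m t \<or> t \<subseteq>\<^sub>m x}"
  obtain B where B: "maximal_branch A B"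
    unfolding maximal_branch_def using pred_on.Hausdorff by blast
  have "t \<in> B"
    using maximal_branch_subset[OF B] assms by (intro maximal_branch_memI[OF B]) (auto simp: A_def)
  have "A \<subseteq> T" by (auto simp: A_def)
  moreover have "S \<subseteq> A" if "pred_on.chain T (\<subseteq>\<^sub>m) S" "B \<subset> S" for S
    using that \<open>t \<in> B\<close> unfolding chain_map_le_iff A_def by blast
  ultimately have "maximal_branch T B"
    using B unfolding maximal_branch_def pred_on.maxchain_def chain_map_le_iff by (meson subset_trans)
  then show thesis using \<open>t \<in> B\<close> by (rule that)
qed

lemma maximal_branch_downward_closed:
  assumes "wo_rel \<kappa>" and T: "tree \<kappa> T" and B: "maximal_branch T B"
    and "x \<in> B" and "s \<in> seqs \<kappa>" and "s \<subseteq>\<^sub>m x"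
  shows "s \<in> B"
proof (rule maximal_branch_memI[OF B])
  have BT: "B \<subseteq> T" using B by (rule maximal_branch_subset)
  then show "s \<in> T" using T assms(4-6) unfolding tree_def by blast
  fix y assume "y \<in> B"
  then consider "x \<subseteq>\<^sub>m y" | "y \<subseteq>\<^sub>m x" using maximal_branch_linear[OF B \<open>x \<in> B\<close>] by blast
  then show "s \<subseteq>\<^sub>m y \<or> y \<subseteq>\<^sub>m s"
  proof cases
    case 1
    with \<open>s \<subseteq>\<^sub>m x\<close> show ?thesis by (blast intro: map_le_trans)
  next
    case 2
    have "y \<in> seqs \<kappa>" using \<open>y \<in> B\<close> BT T unfolding tree_def by blast
    with 2 assms(5,6) show ?thesis by (intro seqs_map_le_linear[OF assms(1)])
  qed
qed

lemma has_cofinality_ordLeq: "has_cofinality \<kappa> B \<Longrightarrow> \<kappa> \<le>o |B|"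
  unfolding has_cofinality_def dominates_def by (meson map_le_refl order_refl)

lemma maximal_branch_restrict_map:
  assumes "wo_rel \<kappa>" and "tree \<kappa> T" and B: "maximal_branch T B"
    and "x \<in> B" and "x \<in> level \<kappa> T \<eta>" and "(\<zeta>, \<eta>) \<in> \<kappa>"
  shows "x |` underS \<kappa> \<zeta> \<in> B" and "x |` underS \<kappa> \<zeta> \<in> level \<kappa> T \<zeta>"
proof -
  have seq: "x |` underS \<kappa> \<zeta> \<in> seqs_of_length \<kappa> \<zeta>"
    using assms(1,5,6) by (auto simp: level_def intro: restrict_map_in_seqs_of_length)
  then have "x |` underS \<kappa> \<zeta> \<in> seqs \<kappa>"
    using FieldI1[OF assms(6)] by (auto simp: seqs_def)
  then show "x |` underS \<kappa> \<zeta> \<in> B"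
    by (rule maximal_branch_downward_closed[OF assms(1-4)])
      (auto simp: map_le_def restrict_map_def dom_def)
  with seq show "x |` underS \<kappa> \<zeta> \<in> level \<kappa> T \<zeta>"
    using maximal_branch_subset[OF B] by (auto simp: level_def)
qed

lemma maximal_branch_meets_level:
  assumes \<kappa>: "Card_order \<kappa>" and T: "tree \<kappa> T" and B: "maximal_branch T B"
    and cofinality: "has_cofinality \<kappa> B" and \<zeta>: "\<zeta> \<in> Field \<kappa>"
  shows "\<exists>x\<in>B. x \<in> level \<kappa> T \<zeta>"
proof (rule ccontr)
  assume misses: "\<not> ?thesis"
  have wo: "wo_rel \<kappa>" using \<kappa> by (rule Card_order_wo_rel)
  have BT: "B \<subseteq> T" using B by (rule maximal_branch_subset)
  have short: "dom x \<in> underS \<kappa> ` underS \<kappa> \<zeta>" if "x \<in> B" for x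
  proof -
    obtain \<eta> where \<eta>: "\<eta> \<in> Field \<kappa>" "x \<in> level \<kappa> T \<eta>"
      using tree_level_cases[OF T] BT \<open>x \<in> B\<close> by blast
    have "(\<zeta>, \<eta>) \<notin> \<kappa>"
      using maximal_branch_restrict_map[OF wo T B \<open>x \<in> B\<close> \<eta>(2)] misses by blast
    then have "\<eta> \<in> underS \<kappa> \<zeta>"
      using wo_rel.TOTALS[OF wo] wo_rel.REFL[OF wo] \<zeta> \<eta>(1)
      by (auto simp: underS_def refl_on_def)
    with \<eta>(2) show ?thesis by (simp add: in_levelD)
  qed
  have "inj_on dom B"
    by (intro inj_onI) (metis map_le_antisym map_le_if_dom_subset maximal_branch_linear[OF B] order_refl)
  then have "|B| \<le>o |underS \<kappa> ` underS \<kappa> \<zeta>|"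
    using short by (intro card_of_ordLeqI[of dom]) auto
  also have "|underS \<kappa> ` underS \<kappa> \<zeta>| \<le>o |underS \<kappa> \<zeta>|" by (rule card_of_image)
  also have "|underS \<kappa> \<zeta>| <o \<kappa>" using \<kappa> \<zeta> by (rule card_of_underS)
  finally show False
    using has_cofinality_ordLeq[OF cofinality] not_ordLess_ordLeq by blast
qed

lemma regularCard_if_maximal_branch_has_cofinality:
  assumes \<kappa>: "Card_order \<kappa>" and T: "tree \<kappa> T" and B: "maximal_branch T B"
    and cofinality: "has_cofinality \<kappa> B"
  shows "regularCard \<kappa>"
  unfolding regularCard_def
proof (intro allI impI, elim conjE)
  fix K assume K: "K \<subseteq> Field \<kappa>" "cofinal K \<kappa>"
  have wo: "wo_rel \<kappa>" using \<kappa> by (rule Card_order_wo_rel)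
  obtain node where node: "\<And>\<zeta>. \<zeta> \<in> Field \<kappa> \<Longrightarrow> node \<zeta> \<in> B \<and> node \<zeta> \<in> level \<kappa> T \<zeta>"
    using maximal_branch_meets_level[OF assms] by metis
  have "dominates (node ` K) B"
    unfolding dominates_def
  proof
    fix y assume "y \<in> B"
    then obtain \<eta> where \<eta>: "\<eta> \<in> Field \<kappa>" "y \<in> level \<kappa> T \<eta>"
      using tree_level_cases[OF T] maximal_branch_subset[OF B] by blast
    then obtain \<zeta> where \<zeta>: "\<zeta> \<in> K" "(\<eta>, \<zeta>) \<in> \<kappa>"
      using K(2) unfolding cofinal_def by blast
    then have "y \<subseteq>\<^sub>m node \<zeta>"
      using node[of \<zeta>] K(1) \<eta>(2) \<open>y \<in> B\<close> maximal_branch_linear[OF B]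
      by (intro level_map_le[OF wo]) auto
    with \<zeta>(1) show "\<exists>x\<in>node ` K. y \<subseteq>\<^sub>m x" by blast
  qed
  moreover have "node ` K \<subseteq> B" using node K(1) by blast
  ultimately have "\<kappa> \<le>o |node ` K|"
    using cofinality unfolding has_cofinality_def by blast
  also have "|node ` K| \<le>o |K|" by (rule card_of_image)
  finally have "\<kappa> \<le>o |K|" .
  moreover have "|K| \<le>o \<kappa>"
    using card_of_mono1[OF K(1)] card_of_Field_ordIso[OF \<kappa>] by (rule ordLeq_ordIso_trans)
  ultimately show "|K| =o \<kappa>" by (simp add: ordIso_iff_ordLeq)
qed

section \<open>Colourings of a tree whose branches have full cofinality\<close>

abbreviation immediate_successors :: "'a rel \<Rightarrow> ('a \<rightharpoonup> 'a) set \<Rightarrow> 'a \<Rightarrow> ('a \<rightharpoonup> 'a) \<Rightarrow> ('a \<rightharpoonup> 'a) set" where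
  "immediate_successors \<kappa> T \<zeta> t \<equiv> level \<kappa> T (ord_succ \<kappa> \<zeta>) \<inter> Cone \<kappa> t"

locale full_cofinality_tree =
  fixes \<kappa> :: "'a rel" and T :: "('a \<rightharpoonup> 'a) set"
  assumes Cinfinite: "Cinfinite \<kappa>"
    and kappa_tree: "kappa_tree \<kappa> T"
    and branch_cofinality: "maximal_branch T B \<Longrightarrow> has_cofinality \<kappa> B"
begin

lemma Card_order: "Card_order \<kappa>"
  using Cinfinite by blast

lemma wo_rel: "wo_rel \<kappa>"
  using Card_order by (rule Card_order_wo_rel)

lemma tree: "tree \<kappa> T"
  using kappa_tree by (simp add: kappa_tree_def)

lemma nonempty: "T \<noteq> {}"
proof -
  have "\<kappa> =o |T|" using kappa_tree by (simp add: kappa_tree_def ordIso_symmetric)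
  then have "Cinfinite |T|" using Cinfinite by (rule Cinfinite_cong)
  then show ?thesis by (auto simp: cinfinite_def Field_card_of)
qed

lemma regularCard: "regularCard \<kappa>"
proof -
  obtain B where "maximal_branch T B" using nonempty exists_maximal_branch_through by blast
  then show ?thesis
    using regularCard_if_maximal_branch_has_cofinality[OF Card_order tree] branch_cofinality by blast
qed

lemma level_extension:
  assumes "t \<in> level \<kappa> T \<zeta>" and "(\<zeta>, \<eta>) \<in> \<kappa>"
  obtains x where "x \<in> level \<kappa> T \<eta>" "t \<subseteq>\<^sub>m x"
proof -
  have "t \<in> T" using assms(1) by (simp add: in_levelD)
  then obtain B where B: "maximal_branch T B" "t \<in> B" by (rule exists_maximal_branch_through)
  obtain x where x: "x \<in> B" "x \<in> level \<kappa> T \<eta>"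
    using maximal_branch_meets_level
      [OF Card_order tree B(1) branch_cofinality[OF B(1)] FieldI2[OF assms(2)]] by blast
  moreover have "t \<subseteq>\<^sub>m x"
    using level_map_le[OF wo_rel assms(1) x(2) assms(2)] maximal_branch_linear[OF B x(1)] by blast
  ultimately show thesis using that by blast
qed

lemma immediate_successors_nonempty:
  assumes "\<zeta> \<in> Field \<kappa>" and "t \<in> level \<kappa> T \<zeta>"
  shows "immediate_successors \<kappa> T \<zeta> t \<noteq> {}"
proof -
  obtain s where "s \<in> level \<kappa> T (ord_succ \<kappa> \<zeta>)" "t \<subseteq>\<^sub>m s"
    by (rule level_extension[OF assms(2) ord_succ_greater[OF Cinfinite assms(1)]])
  then show ?thesis using tree unfolding Cone_def tree_def level_def by blast
qed

lemma card_immediate_successors: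
  assumes "\<zeta> \<in> Field \<kappa>"
  shows "|immediate_successors \<kappa> T \<zeta> t| <o \<kappa>"
proof -
  have "|level \<kappa> T (ord_succ \<kappa> \<zeta>)| <o \<kappa>"
    using kappa_tree FieldI2[OF ord_succ_greater[OF Cinfinite assms]] by (simp add: kappa_tree_def)
  then show ?thesis using card_of_mono1[OF Int_lower1] ordLeq_ordLess_trans by blast
qed

definition colour_dominates :: "(('a \<rightharpoonup> 'a) \<Rightarrow> 'c) \<Rightarrow> 'c \<Rightarrow> 'a \<Rightarrow> ('a \<rightharpoonup> 'a) \<Rightarrow> bool" where
  "colour_dominates c i \<zeta> t \<longleftrightarrow> (\<exists>\<eta>\<in>Field \<kappa>. \<zeta> \<in> underS \<kappa> \<eta> \<and>
     dominates {x \<in> level \<kappa> T \<eta>. c x = i} (immediate_successors \<kappa> T \<zeta> t))"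

definition missing_levels :: "(('a \<rightharpoonup> 'a) \<Rightarrow> 'c) \<Rightarrow> 'c set \<Rightarrow> ('a \<rightharpoonup> 'a) \<Rightarrow> 'a set" where
  "missing_levels c J t = {\<eta> \<in> Field \<kappa>. \<forall>x\<in>level \<kappa> T \<eta>. t \<subseteq>\<^sub>m x \<longrightarrow> c x \<notin> J}"

lemma immediate_successor_missing_colour:
  assumes \<zeta>: "\<zeta> \<in> Field \<kappa>" and J: "cofinal (missing_levels c J t) \<kappa>"
    and i: "\<not> colour_dominates c i \<zeta> t"
  obtains s where "s \<in> immediate_successors \<kappa> T \<zeta> t"
    "cofinal (missing_levels c (insert i J) s) \<kappa>"
proof -
  let ?S = "immediate_successors \<kappa> T \<zeta> t"
  have "\<exists>s\<in>?S. \<eta> \<in> missing_levels c (insert i J) s"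
    if \<eta>: "\<eta> \<in> missing_levels c J t" "\<zeta> \<in> underS \<kappa> \<eta>" for \<eta>
  proof -
    have "\<eta> \<in> Field \<kappa>" using \<eta>(1) by (simp add: missing_levels_def)
    with i \<eta>(2) obtain s where s: "s \<in> ?S" "\<forall>x\<in>level \<kappa> T \<eta>. s \<subseteq>\<^sub>m x \<longrightarrow> c x \<noteq> i"
      unfolding colour_dominates_def dominates_def by blast
    have "t \<subseteq>\<^sub>m s" using s(1) by (simp add: Cone_def)
    with s \<eta>(1) show ?thesis unfolding missing_levels_def by (blast intro: map_le_trans)
  qed
  then have "{\<eta> \<in> missing_levels c J t. \<zeta> \<in> underS \<kappa> \<eta>}
      \<subseteq> (\<Union>s\<in>?S. missing_levels c (insert i J) s)" by blast
  then have "cofinal (\<Union>s\<in>?S. missing_levels c (insert i J) s) \<kappa>"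
    using cofinal_mono[OF cofinal_strictly_above[OF wo_rel J \<zeta>]] by blast
  from cofinal_UNION_regularCard[OF Card_order regularCard card_immediate_successors[OF \<zeta>] this]
  show thesis using that by blast
qed

lemma exists_colour_dominates:
  assumes K: "finite K" and c: "c \<in> T \<rightarrow> K"
  shows "\<exists>\<zeta>\<in>Field \<kappa>. \<exists>t\<in>level \<kappa> T \<zeta>. \<exists>i. colour_dominates c i \<zeta> t"
proof (rule ccontr)
  assume no_dominating: "\<not> ?thesis"
  have "\<exists>\<zeta>\<in>Field \<kappa>. \<exists>t\<in>level \<kappa> T \<zeta>. cofinal (missing_levels c J t) \<kappa>" if "finite J" for J
    using that
  proof (induction J)
    case empty
    obtain \<zeta> t where "\<zeta> \<in> Field \<kappa>" "t \<in> level \<kappa> T \<zeta>"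
      using nonempty tree_level_cases[OF tree] by blast
    moreover have "missing_levels c {} t = Field \<kappa>" by (simp add: missing_levels_def)
    ultimately show ?case using cofinal_Field[OF Cinfinite] by metis
  next
    case (insert i J)
    then obtain \<zeta> t where \<zeta>: "\<zeta> \<in> Field \<kappa>" and t: "t \<in> level \<kappa> T \<zeta>"
      and missing: "cofinal (missing_levels c J t) \<kappa>" by blast
    have "\<not> colour_dominates c i \<zeta> t" using no_dominating \<zeta> t by blast
    with \<zeta> missing obtain s where "s \<in> immediate_successors \<kappa> T \<zeta> t"
      "cofinal (missing_levels c (insert i J) s) \<kappa>"
      by (rule immediate_successor_missing_colour)
    with FieldI2[OF ord_succ_greater[OF Cinfinite \<zeta>]] show ?case by blast
  qed
  from this[OF K] obtain \<zeta> t where "\<zeta> \<in> Field \<kappa>" and t: "t \<in> level \<kappa> T \<zeta>"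
    and "cofinal (missing_levels c K t) \<kappa>" by blast
  then obtain \<eta> where \<eta>: "\<eta> \<in> missing_levels c K t" "(\<zeta>, \<eta>) \<in> \<kappa>"
    unfolding cofinal_def by blast
  obtain x where x: "x \<in> level \<kappa> T \<eta>" "t \<subseteq>\<^sub>m x" by (rule level_extension[OF t \<eta>(2)])
  with \<eta>(1) have "c x \<notin> K" by (simp add: missing_levels_def)
  with c in_levelD[OF x(1)] show False by blast
qed

lemma exists_monochromatic_dominating:
  assumes "finite K" and "c \<in> T \<rightarrow> K"
  shows "\<exists>\<eta>\<in>Field \<kappa>. \<exists>\<zeta>\<in>underS \<kappa> \<eta>. \<exists>t\<in>level \<kappa> T \<zeta>. \<exists>X\<subseteq>level \<kappa> T \<eta>.
    dominates X (immediate_successors \<kappa> T \<zeta> t) \<and> is_singleton (c ` X)"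
proof -
  obtain i \<zeta> t where \<zeta>: "\<zeta> \<in> Field \<kappa>" and t: "t \<in> level \<kappa> T \<zeta>" and "colour_dominates c i \<zeta> t"
    using exists_colour_dominates[OF assms] by blast
  then obtain \<eta> where \<eta>: "\<eta> \<in> Field \<kappa>" "\<zeta> \<in> underS \<kappa> \<eta>"
    and dominates: "dominates {x \<in> level \<kappa> T \<eta>. c x = i} (immediate_successors \<kappa> T \<zeta> t)"
      (is "dominates ?X _")
    unfolding colour_dominates_def by blast
  then have "?X \<noteq> {}"
    using immediate_successors_nonempty[OF \<zeta> t] unfolding dominates_def by blast
  then have "c ` ?X = {i}" by auto
  then have "is_singleton (c ` ?X)" by simp
  with dominates show ?thesis
    by (intro bexI[OF _ \<eta>(1)] bexI[OF _ \<eta>(2)] bexI[OF _ t] exI[of _ ?X] conjI) auto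
qed

end

section \<open>Level products with a single factor\<close>

lemma level_product_singleton:
  assumes "Field \<delta> = {d}" and "X d \<subseteq> seqs \<kappa>"
  shows "level_product \<kappa> \<delta> X = (\<lambda>x. \<lambda>i\<in>{d}. x) ` X d"
proof -
  have "(\<Union>\<zeta>\<in>Field \<kappa>. level \<kappa> (X d) \<zeta>) = X d"
    using assms(2) unfolding level_def seqs_def by blast
  moreover have "(\<Pi>\<^sub>E i\<in>{d}. level \<kappa> (X i) \<zeta>) = (\<lambda>x. \<lambda>i\<in>{d}. x) ` level \<kappa> (X d) \<zeta>" for \<zeta>
    by (simp only: PiE_over_singleton_iff UNION_singleton_eq_range)
  ultimately show ?thesis
    by (simp only: level_product_def assms(1) image_UN[symmetric])
qed

lemma SDHL_singletonI:
  fixes \<kappa> :: "'a rel" and \<delta> :: "'d rel" and \<sigma> :: "'s rel"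
  assumes \<delta>: "Field \<delta> = {d}"
    and single_tree: "\<And>T c. regular_tree \<kappa> T \<Longrightarrow> c \<in> T \<rightarrow> Field \<sigma> \<Longrightarrow>
      \<exists>\<eta>\<in>Field \<kappa>. \<exists>\<zeta>\<in>underS \<kappa> \<eta>. \<exists>t\<in>level \<kappa> T \<zeta>. \<exists>X\<subseteq>level \<kappa> T \<eta>.
        dominates X (immediate_successors \<kappa> T \<zeta> t) \<and> is_singleton (c ` X)"
  shows "SDHL \<delta> \<sigma> \<kappa>"
  unfolding SDHL_def
proof (intro allI impI, elim conjE)
  fix T :: "'d \<Rightarrow> ('a \<rightharpoonup> 'a) set" and c :: "('d \<Rightarrow> 'a \<rightharpoonup> 'a) \<Rightarrow> 's"
  assume "\<forall>i\<in>Field \<delta>. regular_tree \<kappa> (T i)" and c: "c \<in> level_product \<kappa> \<delta> T \<rightarrow> Field \<sigma>"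
  then have T: "regular_tree \<kappa> (T d)" by (simp add: \<delta>)
  then have seqs: "T d \<subseteq> seqs \<kappa>" by (simp add: regular_tree_def kappa_tree_def tree_def)
  let ?const = "\<lambda>x. \<lambda>i\<in>{d}. x"
  have "(c \<circ> ?const) \<in> T d \<rightarrow> Field \<sigma>"
    using c by (simp add: level_product_singleton[where X = T, OF \<delta> seqs] Pi_iff)
  from single_tree[OF T this] obtain \<eta> \<zeta> t X
    where \<eta>: "\<eta> \<in> Field \<kappa>" "\<zeta> \<in> underS \<kappa> \<eta>" "t \<in> level \<kappa> (T d) \<zeta>"
      and X: "X \<subseteq> level \<kappa> (T d) \<eta>" "dominates X (immediate_successors \<kappa> (T d) \<zeta> t)"
      and singleton: "is_singleton ((c \<circ> ?const) ` X)" by blast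
  have "X \<subseteq> seqs \<kappa>" using X(1) seqs unfolding level_def by blast
  then have "c ` level_product \<kappa> \<delta> (\<lambda>_. X) = (c \<circ> ?const) ` X"
    by (simp add: level_product_singleton[OF \<delta>] image_comp)
  with singleton have "card (c ` level_product \<kappa> \<delta> (\<lambda>_. X)) = 1"
    by (simp add: is_singleton_altdef)
  with \<eta>(3) X show "\<exists>\<zeta>'\<in>Field \<kappa>. \<exists>\<zeta>\<in>underS \<kappa> \<zeta>'. \<exists>t X.
      (\<forall>i\<in>Field \<delta>. t i \<in> level \<kappa> (T i) \<zeta> \<and> X i \<subseteq> level \<kappa> (T i) \<zeta>' \<and>
        dominates (X i) (immediate_successors \<kappa> (T i) \<zeta> (t i))) \<and>
      card (c ` level_product \<kappa> \<delta> X) = 1"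
    by (intro bexI[OF _ \<eta>(1)] bexI[OF _ \<eta>(2)] exI[of _ "\<lambda>_. t"] exI[of _ "\<lambda>_. X"])
      (simp add: \<delta>)
qed

lemma SDHL_singleton_finite:
  fixes \<kappa> :: "'a rel" and \<delta> :: "'d rel" and \<sigma> :: "'s rel"
  assumes "Cinfinite \<kappa>" and "Field \<delta> = {d}" and "finite (Field \<sigma>)"
  shows "SDHL \<delta> \<sigma> \<kappa>"
proof (rule SDHL_singletonI[OF assms(2)])
  fix T :: "('a \<rightharpoonup> 'a) set" and c :: "('a \<rightharpoonup> 'a) \<Rightarrow> 's"
  assume "regular_tree \<kappa> T" and c: "c \<in> T \<rightarrow> Field \<sigma>"
  then interpret full_cofinality_tree \<kappa> T
    using assms(1) by (simp add: full_cofinality_tree_def regular_tree_def)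
  show "\<exists>\<eta>\<in>Field \<kappa>. \<exists>\<zeta>\<in>underS \<kappa> \<eta>. \<exists>t\<in>level \<kappa> T \<zeta>. \<exists>X\<subseteq>level \<kappa> T \<eta>.
      dominates X (immediate_successors \<kappa> T \<zeta> t) \<and> is_singleton (c ` X)"
    using assms(3) c by (rule exists_monochromatic_dominating)
qed

theorem fact2p4:
  fixes \<kappa> :: "'a rel" and k :: nat
  assumes "Cinfinite \<kappa>" and "k > 0"
  shows "SDHL (natLeq_on 1) (natLeq_on k) \<kappa>"
proof (rule SDHL_singleton_finite[OF assms(1)])
  show "Field (natLeq_on 1) = {0}" by (subst Field_natLeq_on) auto
  show "finite (Field (natLeq_on k))" by (simp add: Field_natLeq_on)
qed

end
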